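(* Let $G_1$ be an $(N_1,D_1,\lambda_1)$-graph on vertex set $[N_1]$ and let $G_2$ be a $(D_1,D_2,\lambda_2)$-graph on vertex set $[D_1]$. Then the zig-zag product of $G_1$ and $G_2$ is an $(N_1\cdot D_1,\; D_2^2,\; \lambda_1+\lambda_2+\lambda_2^2)$-graph.
   Context: For a positive integer $n$, $[n]=\{1,\dots,n\}$. Graphs are finite, undirected and regular, and may have self-loops and parallel edges. A $D$-regular graph $G$ on $[N]$ is specified by its rotation map $\mathrm{Rot}_G:[N]\times[D]\to[N]\times[D]$: $\mathrm{Rot}_G(v,i)=(w,j)$ means that the $i$-th edge incident to $v$ leads to $w$ and that this edge is the $j$-th edge incident to $w$. Thus $\mathrm{Rot}_G$ is a permutation with $\mathrm{Rot}_G\circ\mathrm{Rot}_G=\mathrm{id}$ (and any such involution specifies a $D$-regular graph). Vertex sets and sets of edge labels may be any finite sets of the right cardinality. The normalized adjacency matrix of $G$ is the symmetric $N\times N$ matrix with $M_{u,v}=\frac1D|\{(i,j)\in[D]^2:\mathrm{Rot}_G(u,i)=(v,j)\}|$. The second largest eigenvalue in absolute value is $\lambda(G)=\max_{\alpha\perp 1_N,\,\alpha\ne0}\|M\alpha\|/\|\alpha\|$, where $1_N$ is the all-ones vector and the norm is Euclidean (with $\lambda(G)=0$ if $N=1$). An $(N,D,\lambda)$-graph is a $D$-regular graph on $N$ vertices with $\lambda(G)\le\lambda$. Zig-zag product: for a $D_1$-regular graph $G_1$ on $[N_1]$ and a $D_2$-regular graph $G_2$ on $[D_1]$, it is the $D_2^2$-regular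 graph on $[N_1]\times[D_1]$, with edge labels in $[D_2]\times[D_2]$, whose rotation map sends $((v,k),(i,j))$ to $((w,\ell),(j',i'))$, where $(k',i')=\mathrm{Rot}_{G_2}(k,i)$, then $(w,\ell')=\mathrm{Rot}_{G_1}(v,k')$, then $(\ell,j')=\mathrm{Rot}_{G_2}(\ell',j)$. *)

theory Defs
  imports "HOL-Analysis.Analysis"
begin

text \<open>
  A regular graph, with loops and parallel edges allowed, is given by its rotation map. Only the
  values of the rotation map on \<open>verts G \<times> labels G\<close> are relevant; it is otherwise arbitrary.
\<close>

record ('v, 'l) rot_graph =
  verts :: "'v set"
  labels :: "'l set"
  rot :: "'v \<times> 'l \<Rightarrow> 'v \<times> 'l"

definition regular_graph :: "('v, 'l) rot_graph \<Rightarrow> bool" where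
  "regular_graph G \<longleftrightarrow>
     finite (verts G) \<and> verts G \<noteq> {} \<and> finite (labels G) \<and> labels G \<noteq> {} \<and>
     (\<forall>x \<in> verts G \<times> labels G. rot G x \<in> verts G \<times> labels G \<and> rot G (rot G x) = x)"

definition norm_adj :: "('v, 'l) rot_graph \<Rightarrow> 'v \<Rightarrow> 'v \<Rightarrow> real" where
  "norm_adj G u v =
     real (card {(i, j). i \<in> labels G \<and> j \<in> labels G \<and> rot G (u, i) = (v, j)})
       / real (card (labels G))"

definition adj_apply :: "('v, 'l) rot_graph \<Rightarrow> ('v \<Rightarrow> real) \<Rightarrow> 'v \<Rightarrow> real" where
  "adj_apply G \<alpha> u = (\<Sum>v\<in>verts G. norm_adj G u v * \<alpha> v)"

text \<open>
  Vectors indexed by the vertex set are functions of which only the values on \<open>verts G\<close> matter;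
  \<open>L2_set \<alpha> (verts G)\<close> is the Euclidean norm. The maximum in the definition of \<open>\<lambda>(G)\<close> ranges over an
  infinite set of ratios and is written as a supremum; lemma \<open>lambda_is_max\<close> shows that it is attained.
\<close>

definition perp_ones :: "('v, 'l) rot_graph \<Rightarrow> ('v \<Rightarrow> real) \<Rightarrow> bool" where
  "perp_ones G \<alpha> \<longleftrightarrow> (\<Sum>v\<in>verts G. \<alpha> v) = 0"

definition nonzero_vec :: "('v, 'l) rot_graph \<Rightarrow> ('v \<Rightarrow> real) \<Rightarrow> bool" where
  "nonzero_vec G \<alpha> \<longleftrightarrow> (\<exists>v\<in>verts G. \<alpha> v \<noteq> 0)"

definition lambda :: "('v, 'l) rot_graph \<Rightarrow> real" where
  "lambda G =
     (if card (verts G) = 1 then 0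
      else Sup {L2_set (adj_apply G \<alpha>) (verts G) / L2_set \<alpha> (verts G) | \<alpha>.
                  perp_ones G \<alpha> \<and> nonzero_vec G \<alpha>})"

definition spectral_graph :: "nat \<Rightarrow> nat \<Rightarrow> real \<Rightarrow> ('v, 'l) rot_graph \<Rightarrow> bool" where
  "spectral_graph N D l G \<longleftrightarrow>
     regular_graph G \<and> card (verts G) = N \<and> card (labels G) = D \<and> lambda G \<le> l"

definition zigzag ::
  "('v, 'k) rot_graph \<Rightarrow> ('k, 'l) rot_graph \<Rightarrow> ('v \<times> 'k, 'l \<times> 'l) rot_graph" where
  "zigzag G1 G2 =
     \<lparr> verts = verts G1 \<times> verts G2,
       labels = labels G2 \<times> labels G2,
       rot = (\<lambda>((v, k), (i, j)).
                let (k', i') = rot G2 (k, i);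
                    (w, l') = rot G1 (v, k');
                    (l, j') = rot G2 (l', j)
                in ((w, l), (j', i'))) \<rparr>"

lemma lambda_is_max:
  assumes G: "regular_graph G" and card: "card (verts G) \<noteq> 1"
  shows "\<exists>\<alpha>. perp_ones G \<alpha> \<and> nonzero_vec G \<alpha> \<and>
           L2_set (adj_apply G \<alpha>) (verts G) / L2_set \<alpha> (verts G) = lambda G"
    and "\<And>\<alpha>. perp_ones G \<alpha> \<Longrightarrow> nonzero_vec G \<alpha> \<Longrightarrow>
           L2_set (adj_apply G \<alpha>) (verts G) / L2_set \<alpha> (verts G) \<le> lambda G"
proof -
  define V where "V = verts G"
  define f where "f \<alpha> = L2_set (adj_apply G \<alpha>) V" for \<alpha>
  define R where "R = {f \<alpha> / L2_set \<alpha> V | \<alpha>. perp_ones G \<alpha> \<and> nonzero_vec G \<alpha>}"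
  define B :: "('a \<Rightarrow> real) set" where "B = PiE UNIV (\<lambda>v. if v \<in> V then {-1..1} else {0})"
  define K where "K = B \<inter> {\<alpha>. (\<Sum>v\<in>V. \<alpha> v) = 0 \<and> L2_set \<alpha> V = 1}"
  have fin: "finite V" and ne: "V \<noteq> {}"
    using G by (auto simp: V_def regular_graph_def)
  have cont: "continuous_on UNIV (\<lambda>\<alpha>::'a \<Rightarrow> real. \<alpha> v)" for v
    by (rule continuous_on_product_coordinates)
  have "closed {\<alpha>. (\<Sum>v\<in>V. \<alpha> v) = 0 \<and> L2_set \<alpha> V = 1}"
    unfolding L2_set_def
    by (intro closed_Collect_conj closed_Collect_eq continuous_intros cont)
  moreover have "compact B"
    using compactin_PiE[of "\<lambda>_::'a. euclidean :: real topology" UNIV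
        "\<lambda>v. if v \<in> V then {-1..1} else {0}"]
    by (simp add: B_def euclidean_product_topology)
  ultimately have "compact K"
    unfolding K_def by (rule compact_Int_closed[rotated])
  have contf: "continuous_on K f"
    unfolding f_def L2_set_def adj_apply_def
    by (intro continuous_intros continuous_on_subset[OF cont]) auto
  have K_imp: "perp_ones G \<alpha> \<and> nonzero_vec G \<alpha> \<and> f \<alpha> / L2_set \<alpha> V = f \<alpha>" if "\<alpha> \<in> K" for \<alpha>
  proof -
    have "L2_set \<alpha> V = 1" using that by (simp add: K_def)
    moreover have "nonzero_vec G \<alpha>"
    proof (rule ccontr)
      assume "\<not> nonzero_vec G \<alpha>"
      then have "L2_set \<alpha> V = 0"
        by (intro L2_set_0') (auto simp: nonzero_vec_def V_def)
      with \<open>L2_set \<alpha> V = 1\<close> show False by simp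
    qed
    ultimately show ?thesis using that by (simp add: K_def perp_ones_def V_def)
  qed
  have scale: "\<exists>\<beta>\<in>K. f \<beta> = f \<alpha> / L2_set \<alpha> V" if p: "perp_ones G \<alpha>" and n: "nonzero_vec G \<alpha>" for \<alpha>
  proof
    define c where "c = L2_set \<alpha> V"
    define \<beta> where "\<beta> v = (if v \<in> V then (1 / c) * \<alpha> v else 0)" for v
    have "c \<noteq> 0"
      using n fin by (auto simp: c_def L2_set_eq_0_iff nonzero_vec_def V_def)
    then have c: "c > 0" by (simp add: c_def less_le)
    have le: "\<bar>\<alpha> v\<bar> \<le> c" if "v \<in> V" for v
    proof -
      have "\<bar>\<alpha> v\<bar> = L2_set \<alpha> {v}" by (simp add: L2_set_def)
      also have "\<dots> \<le> c"
        unfolding c_def L2_set_def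
        by (intro real_sqrt_le_mono sum_mono2) (use fin that in auto)
      finally show ?thesis .
    qed
    have "L2_set \<beta> V = L2_set (\<lambda>v. (1 / c) * \<alpha> v) V"
      by (rule L2_set_cong) (auto simp: \<beta>_def)
    also have "\<dots> = (1 / c) * L2_set \<alpha> V"
      using c by (intro L2_set_right_distrib[symmetric]) simp
    finally have "L2_set \<beta> V = 1" using c by (simp add: c_def)
    moreover have "(\<Sum>v\<in>V. \<beta> v) = (\<Sum>v\<in>V. (1 / c) * \<alpha> v)"
      by (rule sum.cong) (auto simp: \<beta>_def)
    then have "(\<Sum>v\<in>V. \<beta> v) = 0"
      using p by (simp add: sum_distrib_left[symmetric] sum_divide_distrib[symmetric] perp_ones_def V_def)
    moreover have "\<beta> \<in> B"
    proof -
      have "\<beta> v \<in> {-1..1}" if "v \<in> V" for v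
        using le[OF that] c that by (auto simp: \<beta>_def abs_le_iff field_simps)
      then show ?thesis by (auto simp: B_def \<beta>_def)
    qed
    ultimately show "\<beta> \<in> K" by (simp add: K_def)
    have "adj_apply G \<beta> u = (1 / c) * adj_apply G \<alpha> u" for u
      unfolding adj_apply_def sum_distrib_left
      by (rule sum.cong) (auto simp: \<beta>_def V_def)
    then have "f \<beta> = L2_set (\<lambda>u. (1 / c) * adj_apply G \<alpha> u) V"
      unfolding f_def by (intro L2_set_cong) auto
    also have "\<dots> = (1 / c) * f \<alpha>"
      unfolding f_def using c by (intro L2_set_right_distrib[symmetric]) simp
    finally show "f \<beta> = f \<alpha> / L2_set \<alpha> V" by (simp add: c_def)
  qed
  obtain a b where ab: "a \<in> V" "b \<in> V" "a \<noteq> b"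
  proof -
    have "\<not> card V \<le> Suc 0"
      using card fin ne by (simp add: V_def card_gt_0_iff le_Suc_eq)
    then show ?thesis using that fin by (auto simp: card_le_Suc0_iff_eq)
  qed
  define \<gamma> where "\<gamma> v = (if v = a then 1 else 0) - (if v = b then 1 else (0::real))" for v
  have "perp_ones G \<gamma>" "nonzero_vec G \<gamma>"
    using ab fin by (auto simp: perp_ones_def nonzero_vec_def \<gamma>_def V_def sum_subtractf)
  then have "K \<noteq> {}" using scale by blast
  then obtain \<alpha> where \<alpha>: "\<alpha> \<in> K" "\<And>\<beta>. \<beta> \<in> K \<Longrightarrow> f \<beta> \<le> f \<alpha>"
    using continuous_attains_sup[OF \<open>compact K\<close> _ contf] by blast
  have ub: "f \<beta> / L2_set \<beta> V \<le> f \<alpha>" if "perp_ones G \<beta>" "nonzero_vec G \<beta>" for \<beta>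
    using scale[OF that] \<alpha>(2) by metis
  have "f \<alpha> \<in> R" unfolding R_def using K_imp[OF \<alpha>(1)] by force
  then have "Sup R = f \<alpha>"
    by (intro cSup_eq_maximum) (auto simp: R_def intro: ub)
  then have lam: "lambda G = f \<alpha>"
    using card by (simp add: lambda_def R_def f_def V_def)
  show "\<exists>\<alpha>. perp_ones G \<alpha> \<and> nonzero_vec G \<alpha> \<and>
           L2_set (adj_apply G \<alpha>) (verts G) / L2_set \<alpha> (verts G) = lambda G"
    using K_imp[OF \<alpha>(1)] lam by (auto simp: f_def V_def)
  show "L2_set (adj_apply G \<beta>) (verts G) / L2_set \<beta> (verts G) \<le> lambda G"
    if "perp_ones G \<beta>" "nonzero_vec G \<beta>" for \<beta>
    using ub[OF that] lam by (simp add: f_def V_def)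
qed

end

theory Submission
  imports Defs
begin

text \<open>
  Write the operator of the zig-zag product as \<open>B A B\<close>, where \<open>B\<close> applies \<open>G2\<close> inside every cloud
  \<open>{v} \<times> verts G2\<close> and \<open>A\<close> is the permutation of coordinates given by the rotation map of \<open>G1\<close>. Let
  \<open>P\<close> be the orthogonal projection averaging over each cloud, and \<open>B' = B (1 - P) = (1 - P) B\<close>, so
  that \<open>B = P + B'\<close> and \<open>B'\<close> has norm at most \<open>\<lambda>2\<close>. In
  \<open>B A B = P A P + (P A B' + B' A P) + B' A B'\<close>, the first term acts as \<open>G1\<close> on cloud averages,
  and hence has norm at most \<open>\<lambda>1\<close> on vectors orthogonal to the ones; the last has norm at most \<open>\<lambda>2\<^sup>2\<close>.
  The two mixed terms have orthogonal domains and orthogonal ranges, so their sum has norm at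
  most \<open>\<lambda>2\<close> and not merely \<open>2 \<lambda>2\<close>.
\<close>

section \<open>Euclidean norms on product sets\<close>

lemma L2_set_power2: "(L2_set f A)\<^sup>2 = (\<Sum>x\<in>A. (f x)\<^sup>2)"
  by (simp add: L2_set_def sum_nonneg)

lemma L2_set_fst_Times:
  "L2_set (\<lambda>x. g (fst x)) (V \<times> K) = sqrt (real (card K)) * L2_set g V"
  by (simp add: L2_set_def real_sqrt_mult[symmetric] sum.cartesian_product' sum_distrib_left)

text \<open>The cross term vanishes cloud by cloud: there \<open>g\<close> is constant and
  \<open>q\<close> sums to zero.\<close>

lemma L2_set_fst_add_power2:
  assumes "\<And>v. v \<in> V \<Longrightarrow> (\<Sum>k\<in>K. q (v, k)) = 0"
  shows "(L2_set (\<lambda>x. g (fst x) + q x) (V \<times> K))\<^sup>2 =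
    (L2_set (\<lambda>x. g (fst x)) (V \<times> K))\<^sup>2 + (L2_set q (V \<times> K))\<^sup>2"
proof -
  have "(\<Sum>x\<in>V \<times> K. 2 * g (fst x) * q x) = (\<Sum>v\<in>V. 2 * g v * (\<Sum>k\<in>K. q (v, k)))"
    by (simp add: sum.cartesian_product' sum_distrib_left)
  also have "\<dots> = 0" using assms by simp
  finally show ?thesis by (simp add: L2_set_power2 power2_sum sum.distrib)
qed

section \<open>The adjacency operator of a regular graph and bounds by \<open>lambda\<close>\<close>

context
  fixes G :: "('v, 'l) rot_graph"
  assumes G: "regular_graph G"
begin

lemma regular_graphD:
  "finite (verts G)" "verts G \<noteq> {}" "finite (labels G)" "labels G \<noteq> {}"
  "\<And>x. x \<in> verts G \<times> labels G \<Longrightarrow> rot G x \<in> verts G \<times> labels G"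
  "\<And>x. x \<in> verts G \<times> labels G \<Longrightarrow> rot G (rot G x) = x"
  using G unfolding regular_graph_def by blast+

lemma sum_rot: "(\<Sum>x\<in>verts G \<times> labels G. f (rot G x)) = (\<Sum>x\<in>verts G \<times> labels G. f x)"
  by (rule sum.reindex_bij_witness[of _ "rot G" "rot G"]) (use regular_graphD(5,6) in auto)

text \<open>An involution only permutes the coordinates. For \<open>G1\<close> this makes the
  operator \<open>A\<close> an isometry.\<close>

lemma L2_set_rot:
  "L2_set (\<lambda>x. f (rot G x)) (verts G \<times> labels G) = L2_set f (verts G \<times> labels G)"
  unfolding L2_set_def using sum_rot[of "\<lambda>x. (f x)\<^sup>2"] by simp

text \<open>At \<open>u\<close> the label \<open>i\<close> determines \<open>j\<close>, so
  \<open>norm_adj\<close> counts the labels leading to \<open>v\<close>; grouping the labels by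
  endpoint gives the mean. In this form compositions of rotation maps can be followed.\<close>

lemma adj_apply_eq_mean:
  assumes u: "u \<in> verts G"
  shows "adj_apply G \<alpha> u = (\<Sum>i\<in>labels G. \<alpha> (fst (rot G (u, i)))) / real (card (labels G))"
proof -
  let ?L = "labels G" and ?V = "verts G"
  have "card {(i, j). i \<in> ?L \<and> j \<in> ?L \<and> rot G (u, i) = (v, j)} =
      card {i \<in> ?L. fst (rot G (u, i)) = v}" for v
    by (rule bij_betw_same_card[of fst], rule bij_betw_byWitness[of _ "\<lambda>i. (i, snd (rot G (u, i)))"])
      (use u regular_graphD(5) in \<open>force simp: mem_Times_iff\<close>)+
  then have "adj_apply G \<alpha> u =
      (\<Sum>v\<in>?V. \<Sum>i | i \<in> ?L \<and> fst (rot G (u, i)) = v. \<alpha> (fst (rot G (u, i)))) / real (card ?L)"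
    by (simp add: adj_apply_def norm_adj_def sum_divide_distrib)
  also have "\<dots> = (\<Sum>i\<in>?L. \<alpha> (fst (rot G (u, i)))) / real (card ?L)"
    using u regular_graphD(1,3,5) by (subst sum.group) (auto simp: mem_Times_iff)
  finally show ?thesis .
qed

lemma adj_apply_const: "u \<in> verts G \<Longrightarrow> adj_apply G (\<lambda>_. c) u = c"
  using regular_graphD(3,4) by (simp add: adj_apply_eq_mean)

text \<open>The columns of the matrix also sum to one, because \<open>rot G\<close> permutes the
  edge ends. Inside a cloud this keeps zero-sum vectors zero-sum.\<close>

lemma sum_adj_apply: "(\<Sum>u\<in>verts G. adj_apply G \<alpha> u) = (\<Sum>u\<in>verts G. \<alpha> u)"
proof -
  have "(\<Sum>u\<in>verts G. adj_apply G \<alpha> u) =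
      (\<Sum>x\<in>verts G \<times> labels G. \<alpha> (fst (rot G x))) / real (card (labels G))"
    by (simp add: adj_apply_eq_mean sum_divide_distrib sum.cartesian_product')
  also have "\<dots> = (\<Sum>u\<in>verts G. \<alpha> u)"
    using regular_graphD(3,4) sum_rot[of "\<lambda>x. \<alpha> (fst x)"]
    by (simp add: sum.cartesian_product' sum_distrib_left[symmetric])
  finally show ?thesis .
qed

lemma lambda_nonneg: "0 \<le> lambda G"
proof (cases "card (verts G) = 1")
  case False
  from lambda_is_max(1)[OF G this] obtain \<alpha>
    where "L2_set (adj_apply G \<alpha>) (verts G) / L2_set \<alpha> (verts G) = lambda G" by blast
  then show ?thesis by (metis L2_set_nonneg divide_nonneg_nonneg)
qed (simp add: lambda_def)

text \<open>The ratio bound of \<open>lambda_is_max\<close> in product form, which also covers the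
  zero vector and one-vertex graphs.\<close>

lemma L2_set_adj_apply_le:
  assumes "(\<Sum>v\<in>verts G. \<alpha> v) = 0"
  shows "L2_set (adj_apply G \<alpha>) (verts G) \<le> lambda G * L2_set \<alpha> (verts G)"
proof (cases "nonzero_vec G \<alpha>")
  case True
  then have pos: "L2_set \<alpha> (verts G) > 0"
    using regular_graphD(1) by (auto simp: less_le L2_set_eq_0_iff nonzero_vec_def)
  \<comment> \<open>On a single vertex, sum zero would force the vector to vanish.\<close>
  have "card (verts G) \<noteq> 1"
    using True assms by (auto simp: nonzero_vec_def card_1_singleton_iff)
  from lambda_is_max(2)[OF G this _ True] pos assms show ?thesis
    by (simp add: perp_ones_def divide_le_eq)
next
  case False
  then have "adj_apply G \<alpha> u = 0" for u
    by (simp add: adj_apply_def nonzero_vec_def)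
  then show ?thesis by (simp add: L2_set_0' lambda_nonneg)
qed

text \<open>The supremum is attained, so the bound is tested at a maximiser;
  \<open>0 \<le> c\<close> serves the one-vertex graph, where \<open>lambda\<close> is 0 by
  convention.\<close>

lemma lambda_leI:
  assumes "0 \<le> c"
    and "\<And>\<alpha>. (\<Sum>v\<in>verts G. \<alpha> v) = 0 \<Longrightarrow>
      L2_set (adj_apply G \<alpha>) (verts G) \<le> c * L2_set \<alpha> (verts G)"
  shows "lambda G \<le> c"
proof (cases "card (verts G) = 1")
  case True
  then show ?thesis using assms(1) by (simp add: lambda_def)
next
  case False
  from lambda_is_max(1)[OF G this] obtain \<alpha> where \<alpha>: "perp_ones G \<alpha>" "nonzero_vec G \<alpha>"
    "L2_set (adj_apply G \<alpha>) (verts G) / L2_set \<alpha> (verts G) = lambda G" by blast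
  then have "L2_set \<alpha> (verts G) > 0"
    using regular_graphD(1) by (auto simp: less_le L2_set_eq_0_iff nonzero_vec_def)
  then show ?thesis
    using assms(2)[of \<alpha>] \<alpha> by (metis perp_ones_def pos_divide_le_eq)
qed

end

section \<open>Linearity, and operators acting cloud by cloud\<close>

lemma adj_apply_add: "adj_apply G (\<lambda>v. \<alpha> v + \<beta> v) u = adj_apply G \<alpha> u + adj_apply G \<beta> u"
  by (simp add: adj_apply_def algebra_simps sum.distrib)

text \<open>\<open>P f\<close> is \<open>\<lambda>x. cloud_mean K f (fst x)\<close>,
  \<open>(1 - P) f\<close> is \<open>cloud_dev K f\<close>, and \<open>B f\<close> is
  \<open>cloud_adj G2 f\<close>. The mean is kept as a function of \<open>v\<close> alone so that
  \<open>G1\<close> can act on it.\<close>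

definition cloud_mean :: "'k set \<Rightarrow> ('v \<times> 'k \<Rightarrow> real) \<Rightarrow> 'v \<Rightarrow> real" where
  "cloud_mean K f v = (\<Sum>k\<in>K. f (v, k)) / real (card K)"

definition cloud_dev :: "'k set \<Rightarrow> ('v \<times> 'k \<Rightarrow> real) \<Rightarrow> 'v \<times> 'k \<Rightarrow> real" where
  "cloud_dev K f x = f x - cloud_mean K f (fst x)"

definition cloud_adj :: "('k, 'l) rot_graph \<Rightarrow> ('v \<times> 'k \<Rightarrow> real) \<Rightarrow> 'v \<times> 'k \<Rightarrow> real" where
  "cloud_adj G f x = adj_apply G (\<lambda>k. f (fst x, k)) (snd x)"

lemma sum_cloud_dev:
  assumes "finite K" "K \<noteq> {}"
  shows "(\<Sum>k\<in>K. cloud_dev K f (v, k)) = 0"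
  using assms by (simp add: cloud_dev_def cloud_mean_def sum_subtractf)

lemma L2_set_cloud_power2:
  assumes "finite K" "K \<noteq> {}"
  shows "(L2_set f (V \<times> K))\<^sup>2 =
    (L2_set (\<lambda>x. cloud_mean K f (fst x)) (V \<times> K))\<^sup>2 + (L2_set (cloud_dev K f) (V \<times> K))\<^sup>2"
proof -
  have "f = (\<lambda>x. cloud_mean K f (fst x) + cloud_dev K f x)"
    by (simp add: cloud_dev_def)
  then show ?thesis
    using L2_set_fst_add_power2[of V "cloud_dev K f" K "cloud_mean K f"] sum_cloud_dev[OF assms]
    by metis
qed

lemma L2_set_cloud_mean_le:
  assumes "finite K" "K \<noteq> {}"
  shows "L2_set (\<lambda>x. cloud_mean K f (fst x)) (V \<times> K) \<le> L2_set f (V \<times> K)"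
  using L2_set_cloud_power2[OF assms, of f V] by (intro power2_le_imp_le[of "L2_set _ _"]) simp_all

lemma L2_set_cloud_dev_le:
  assumes "finite K" "K \<noteq> {}"
  shows "L2_set (cloud_dev K f) (V \<times> K) \<le> L2_set f (V \<times> K)"
  using L2_set_cloud_power2[OF assms, of f V] by (intro power2_le_imp_le[of "L2_set _ _"]) simp_all

text \<open>This is \<open>B = P + B (1 - P)\<close>: vectors constant on a cloud are fixed by
  \<open>G\<close>.\<close>

lemma cloud_adj_split:
  assumes "regular_graph G" "k \<in> verts G"
  shows "cloud_adj G f (v, k) =
    cloud_mean (verts G) f v + cloud_adj G (cloud_dev (verts G) f) (v, k)"
proof -
  have "cloud_adj G f (v, k) =
      adj_apply G (\<lambda>k. cloud_mean (verts G) f v + cloud_dev (verts G) f (v, k)) k"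
    by (simp add: cloud_adj_def cloud_dev_def)
  then show ?thesis
    by (simp add: adj_apply_add adj_apply_const[OF assms] cloud_adj_def)
qed

text \<open>The bound by \<open>lambda G\<close> holds in each cloud separately, and the squared
  cloud norms add up.\<close>

lemma L2_set_cloud_adj_le:
  assumes G: "regular_graph G" and "\<And>v. v \<in> V \<Longrightarrow> (\<Sum>k\<in>verts G. f (v, k)) = 0"
  shows "L2_set (cloud_adj G f) (V \<times> verts G) \<le> lambda G * L2_set f (V \<times> verts G)"
proof (rule power2_le_imp_le)
  have "(L2_set (cloud_adj G f) (V \<times> verts G))\<^sup>2 =
      (\<Sum>v\<in>V. (L2_set (adj_apply G (\<lambda>k. f (v, k))) (verts G))\<^sup>2)"
    by (simp add: L2_set_power2 sum.cartesian_product' cloud_adj_def)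
  also have "\<dots> \<le> (\<Sum>v\<in>V. (lambda G * L2_set (\<lambda>k. f (v, k)) (verts G))\<^sup>2)"
    by (intro sum_mono power_mono L2_set_adj_apply_le[OF G] assms(2)) auto
  also have "\<dots> = (lambda G * L2_set f (V \<times> verts G))\<^sup>2"
    by (simp add: L2_set_power2 sum.cartesian_product' power_mult_distrib sum_distrib_left)
  finally show "(L2_set (cloud_adj G f) (V \<times> verts G))\<^sup>2 \<le> (lambda G * L2_set f (V \<times> verts G))\<^sup>2" .
qed (simp add: lambda_nonneg[OF G])

section \<open>The zig-zag product\<close>

context
  fixes G1 :: "('v, 'k) rot_graph" and G2 :: "('k, 'l) rot_graph"
  assumes G1: "regular_graph G1" and G2: "regular_graph G2"
    and verts_G2: "verts G2 = labels G1"
begin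

text \<open>Walking back undoes the last \<open>G2\<close>-step first, which is why the returned
  label is \<open>(j', i')\<close> in this order.\<close>

lemma regular_graph_zigzag: "regular_graph (zigzag G1 G2)"
proof -
  note r1 = regular_graphD[OF G1] and r2 = regular_graphD[OF G2, unfolded verts_G2]
  have "rot (zigzag G1 G2) x \<in> verts (zigzag G1 G2) \<times> labels (zigzag G1 G2) \<and>
      rot (zigzag G1 G2) (rot (zigzag G1 G2) x) = x"
    if x: "x \<in> verts (zigzag G1 G2) \<times> labels (zigzag G1 G2)" for x
  proof -
    obtain v k i j where x_eq: "x = ((v, k), (i, j))" by (metis surj_pair)
    obtain k' i' where 1: "rot G2 (k, i) = (k', i')" by fastforce
    obtain w l' where 2: "rot G1 (v, k') = (w, l')" by fastforce
    obtain l j' where 3: "rot G2 (l', j) = (l, j')" by fastforce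
    have m: "v \<in> verts G1" "k \<in> labels G1" "i \<in> labels G2" "j \<in> labels G2"
      using x by (auto simp: x_eq zigzag_def verts_G2)
    have m1: "k' \<in> labels G1" "i' \<in> labels G2" "rot G2 (k', i') = (k, i)"
      using r2(5,6)[of "(k, i)"] m 1 by auto
    have m2: "w \<in> verts G1" "l' \<in> labels G1" "rot G1 (w, l') = (v, k')"
      using r1(5,6)[of "(v, k')"] m m1 2 by auto
    have m3: "l \<in> labels G1" "j' \<in> labels G2" "rot G2 (l, j') = (l', j)"
      using r2(5,6)[of "(l', j)"] m m2 3 by auto
    show ?thesis
      using m m1 m2 m3 by (simp add: x_eq zigzag_def verts_G2 1 2 3)
  qed
  moreover have "finite (verts (zigzag G1 G2))" "verts (zigzag G1 G2) \<noteq> {}"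
    "finite (labels (zigzag G1 G2))" "labels (zigzag G1 G2) \<noteq> {}"
    using r1(1-4) r2(1-4) by (simp_all add: zigzag_def verts_G2)
  ultimately show ?thesis
    unfolding regular_graph_def by blast
qed

text \<open>The factorization \<open>B A B\<close>: \<open>i\<close> is averaged by the outer
  \<open>B\<close>, \<open>j\<close> by the inner one, and the \<open>G1\<close>-step between them
  consumes no label of its own.\<close>

lemma adj_apply_zigzag:
  assumes v: "v \<in> verts G1" and k: "k \<in> verts G2"
  shows "adj_apply (zigzag G1 G2) \<alpha> (v, k) =
    cloud_adj G2 (\<lambda>x. cloud_adj G2 \<alpha> (rot G1 x)) (v, k)"
proof -
  let ?d = "real (card (labels G2))"
  have k': "fst (rot G2 (k, i)) \<in> labels G1" if "i \<in> labels G2" for i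
    using regular_graphD(5)[OF G2, of "(k, i)"] k that verts_G2 by (simp add: mem_Times_iff)
  have l': "snd (rot G1 (v, fst (rot G2 (k, i)))) \<in> verts G2" if "i \<in> labels G2" for i
    using regular_graphD(5)[OF G1, of "(v, fst (rot G2 (k, i)))"] v k'[OF that] verts_G2
    by (simp add: mem_Times_iff)
  have "adj_apply (zigzag G1 G2) \<alpha> (v, k) =
      (\<Sum>i\<in>labels G2. \<Sum>j\<in>labels G2. \<alpha> (fst (rot (zigzag G1 G2) ((v, k), (i, j))))) / (?d * ?d)"
    using adj_apply_eq_mean[OF regular_graph_zigzag, of "(v, k)" \<alpha>] v k
    by (simp add: zigzag_def sum.cartesian_product' card_cartesian_product)
  also have "\<dots> = (\<Sum>i\<in>labels G2. (\<Sum>j\<in>labels G2. \<alpha> (fst (rot G1 (v, fst (rot G2 (k, i)))),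
      fst (rot G2 (snd (rot G1 (v, fst (rot G2 (k, i)))), j)))) / ?d) / ?d"
    by (simp add: zigzag_def case_prod_beta Let_def sum_divide_distrib)
  also have "\<dots> = cloud_adj G2 (\<lambda>x. cloud_adj G2 \<alpha> (rot G1 x)) (v, k)"
    using k l' by (simp add: cloud_adj_def adj_apply_eq_mean[OF G2])
  finally show ?thesis .
qed

lemma L2_set_adj_apply_zigzag_le:
  assumes \<alpha>: "(\<Sum>x\<in>verts G1 \<times> verts G2. \<alpha> x) = 0"
  shows "L2_set (adj_apply (zigzag G1 G2) \<alpha>) (verts G1 \<times> verts G2) \<le>
    (lambda G1 + lambda G2 + (lambda G2)\<^sup>2) * L2_set \<alpha> (verts G1 \<times> verts G2)"
proof -
  let ?V = "verts G1" and ?K = "verts G2"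
  define S where "S = ?V \<times> ?K"
  note K = regular_graphD(1,2)[OF G2]
  note l1 = lambda_nonneg[OF G1] and l2 = lambda_nonneg[OF G2]
  \<comment> \<open>Here \<open>p\<close>, \<open>q\<close>, \<open>b\<close> are
    \<open>P \<alpha>\<close>, \<open>(1 - P) \<alpha>\<close>, \<open>B' \<alpha>\<close>. The four
    terms become \<open>h\<close> for \<open>P A P\<close>, \<open>m\<close> for
    \<open>P A B'\<close>, \<open>cloud_adj G2 r\<close> for \<open>B' A P\<close> and
    \<open>cloud_adj G2 s\<close> for \<open>B' A B'\<close>.\<close>
  define g where "g = cloud_mean ?K \<alpha>"
  define p where "p x = g (fst x)" for x :: "'v \<times> 'k"
  define q where "q = cloud_dev ?K \<alpha>"
  define b where "b = cloud_adj G2 q"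
  define Ap where "Ap x = p (rot G1 x)" for x
  define Ab where "Ab x = b (rot G1 x)" for x
  define h where "h = cloud_mean ?K Ap"
  define r where "r = cloud_dev ?K Ap"
  define m where "m = cloud_mean ?K Ab"
  define s where "s = cloud_dev ?K Ab"
  have dev_le: "L2_set (cloud_adj G2 (cloud_dev ?K f)) S \<le> lambda G2 * L2_set (cloud_dev ?K f) S" for f
    unfolding S_def by (rule L2_set_cloud_adj_le[OF G2 sum_cloud_dev[OF K]])
  have rot_S: "L2_set (\<lambda>x. f (rot G1 x)) S = L2_set f S" for f :: "'v \<times> 'k \<Rightarrow> real"
    using L2_set_rot[OF G1] by (simp add: S_def verts_G2)
  have Ap_norm: "L2_set Ap S = L2_set p S" and Ab_norm: "L2_set Ab S = L2_set b S"
    unfolding Ap_def Ab_def by (rule rot_S)+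
  have pyth: "(L2_set \<alpha> S)\<^sup>2 = (L2_set p S)\<^sup>2 + (L2_set q S)\<^sup>2"
    using L2_set_cloud_power2[OF K, of \<alpha> ?V] by (simp add: p_def[abs_def] g_def q_def S_def)
  have p_le: "L2_set p S \<le> L2_set \<alpha> S" and q_le: "L2_set q S \<le> L2_set \<alpha> S"
    by (rule power2_le_imp_le; simp add: pyth)+
  have b_le: "L2_set b S \<le> lambda G2 * L2_set q S"
    unfolding b_def q_def by (rule dev_le)

  have split: "adj_apply (zigzag G1 G2) \<alpha> x =
      h (fst x) + (m (fst x) + cloud_adj G2 r x) + cloud_adj G2 s x" if x: "x \<in> S" for x
  proof -
    obtain v k where vk: "x = (v, k)" "v \<in> ?V" "k \<in> ?K" using x by (auto simp: S_def)
    have "cloud_adj G2 \<alpha> (rot G1 (v, k')) = Ap (v, k') + Ab (v, k')" if "k' \<in> ?K" for k'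
    proof -
      have "snd (rot G1 (v, k')) \<in> ?K"
        using regular_graphD(5)[OF G1, of "(v, k')"] vk that verts_G2 by (simp add: mem_Times_iff)
      from cloud_adj_split[OF G2 this, of \<alpha> "fst (rot G1 (v, k'))"] show ?thesis
        by (simp add: Ap_def Ab_def p_def b_def g_def q_def)
    qed
    \<comment> \<open>\<open>adj_apply G2\<close> reads its argument only on \<open>?K\<close>,
      where the identity was just shown.\<close>
    then have "cloud_adj G2 (\<lambda>x. cloud_adj G2 \<alpha> (rot G1 x)) (v, k) =
        adj_apply G2 (\<lambda>k'. Ap (v, k') + Ab (v, k')) k"
      unfolding cloud_adj_def[of _ "\<lambda>x. cloud_adj G2 \<alpha> (rot G1 x)"] by (simp add: adj_apply_def)
    then have "adj_apply (zigzag G1 G2) \<alpha> x = adj_apply G2 (\<lambda>k'. Ap (v, k') + Ab (v, k')) k"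
      using vk by (simp add: adj_apply_zigzag)
    also have "\<dots> = cloud_adj G2 Ap x + cloud_adj G2 Ab x"
      by (simp add: adj_apply_add cloud_adj_def vk)
    finally show ?thesis
      using vk by (simp add: cloud_adj_split[OF G2, of k Ap] cloud_adj_split[OF G2, of k Ab]
          h_def m_def r_def s_def)
  qed

  \<comment> \<open>Orthogonality to the ones passes to the cloud means, so the spectral bound of
    \<open>G1\<close> applies to \<open>g\<close>.\<close>
  have "(\<Sum>v\<in>?V. g v) = 0"
    using \<alpha> by (simp add: g_def cloud_mean_def sum_divide_distrib[symmetric] sum.cartesian_product')
  note L2_set_adj_apply_le[OF G1 this]
  moreover have "L2_set h ?V = L2_set (adj_apply G1 g) ?V"
    by (rule L2_set_cong)
      (simp_all add: h_def cloud_mean_def Ap_def p_def adj_apply_eq_mean[OF G1] verts_G2)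
  \<comment> \<open>Lifting from \<open>?V\<close> to \<open>S\<close> scales both norms by the same
    factor \<open>sqrt (card ?K)\<close>.\<close>
  ultimately have "L2_set (\<lambda>x. h (fst x)) S \<le> lambda G1 * L2_set p S"
    unfolding S_def p_def L2_set_fst_Times
    by (metis mult.left_commute mult_left_mono of_nat_0_le_iff real_sqrt_ge_zero)
  then have first: "L2_set (\<lambda>x. h (fst x)) S \<le> lambda G1 * L2_set \<alpha> S"
    using mult_left_mono[OF p_le l1] by linarith

  have "L2_set (\<lambda>x. m (fst x)) S \<le> L2_set Ab S"
    unfolding m_def S_def by (rule L2_set_cloud_mean_le[OF K])
  then have m_le: "L2_set (\<lambda>x. m (fst x)) S \<le> lambda G2 * L2_set q S"
    using b_le by (simp add: Ab_norm)
  have "L2_set r S \<le> L2_set p S"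
    using L2_set_cloud_dev_le[OF K, of Ap ?V] Ap_norm by (simp add: r_def S_def)
  then have r_le: "L2_set (cloud_adj G2 r) S \<le> lambda G2 * L2_set p S"
    using dev_le[of Ap] mult_left_mono[OF _ l2] unfolding r_def by fastforce
  \<comment> \<open>This makes the ranges of the two mixed terms orthogonal.\<close>
  have "(\<Sum>k\<in>?K. cloud_adj G2 r (v, k)) = 0" for v
    using sum_adj_apply[OF G2, of "\<lambda>k. r (v, k)"] sum_cloud_dev[OF K]
    by (simp add: cloud_adj_def r_def)
  then have "(L2_set (\<lambda>x. m (fst x) + cloud_adj G2 r x) S)\<^sup>2 =
      (L2_set (\<lambda>x. m (fst x)) S)\<^sup>2 + (L2_set (cloud_adj G2 r) S)\<^sup>2"
    unfolding S_def by (rule L2_set_fst_add_power2)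
  \<comment> \<open>One mixed term is bounded through \<open>q\<close>, the other through
    \<open>p\<close>, so \<open>pyth\<close> recombines the squares into the norm of
    \<open>\<alpha>\<close>.\<close>
  also have "\<dots> \<le> (lambda G2 * L2_set q S)\<^sup>2 + (lambda G2 * L2_set p S)\<^sup>2"
    by (intro add_mono power_mono m_le r_le) auto
  also have "\<dots> = (lambda G2 * L2_set \<alpha> S)\<^sup>2"
    by (simp add: power_mult_distrib pyth algebra_simps)
  finally have mixed: "L2_set (\<lambda>x. m (fst x) + cloud_adj G2 r x) S \<le> lambda G2 * L2_set \<alpha> S"
    by (rule power2_le_imp_le) (simp add: l2)

  \<comment> \<open>One factor \<open>lambda G2\<close> comes from \<open>b\<close>, the second from
    the outer \<open>cloud_adj G2\<close>.\<close>
  have "L2_set s S \<le> L2_set b S"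
    using L2_set_cloud_dev_le[OF K, of Ab ?V] Ab_norm by (simp add: s_def S_def)
  also note b_le
  also have "lambda G2 * L2_set q S \<le> lambda G2 * L2_set \<alpha> S"
    by (rule mult_left_mono[OF q_le l2])
  finally have "lambda G2 * L2_set s S \<le> lambda G2 * (lambda G2 * L2_set \<alpha> S)"
    by (rule mult_left_mono[OF _ l2])
  then have last: "L2_set (cloud_adj G2 s) S \<le> (lambda G2)\<^sup>2 * L2_set \<alpha> S"
    using dev_le[of Ab] by (simp add: s_def power2_eq_square mult.assoc)

  have "L2_set (adj_apply (zigzag G1 G2) \<alpha>) S =
      L2_set (\<lambda>x. h (fst x) + (m (fst x) + cloud_adj G2 r x) + cloud_adj G2 s x) S"
    by (rule L2_set_cong) (simp_all add: split)
  also have "\<dots> \<le> L2_set (\<lambda>x. h (fst x)) S + L2_set (\<lambda>x. m (fst x) + cloud_adj G2 r x) S +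
      L2_set (cloud_adj G2 s) S"
    by (intro order_trans[OF L2_set_triangle_ineq] add_right_mono L2_set_triangle_ineq)
  also have "\<dots> \<le> (lambda G1 + lambda G2 + (lambda G2)\<^sup>2) * L2_set \<alpha> S"
    using first mixed last by (simp add: algebra_simps)
  finally show ?thesis by (simp add: S_def)
qed

lemma lambda_zigzag_le: "lambda (zigzag G1 G2) \<le> lambda G1 + lambda G2 + (lambda G2)\<^sup>2"
  using L2_set_adj_apply_zigzag_le lambda_nonneg[OF G1] lambda_nonneg[OF G2]
  by (intro lambda_leI[OF regular_graph_zigzag]) (simp_all add: zigzag_def)

end

theorem theorem1p3:
  fixes G1 :: "('v, 'k) rot_graph" and G2 :: "('k, 'l) rot_graph"
    and N1 D1 D2 :: nat and l1 l2 :: real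
  assumes "spectral_graph N1 D1 l1 G1"
    and "spectral_graph D1 D2 l2 G2"
    and "verts G2 = labels G1"
  shows "spectral_graph (N1 * D1) (D2\<^sup>2) (l1 + l2 + l2\<^sup>2) (zigzag G1 G2)"
proof -
  have G: "regular_graph G1" "regular_graph G2" and le: "lambda G1 \<le> l1" "lambda G2 \<le> l2"
    using assms by (auto simp: spectral_graph_def)
  note lambda_zigzag_le[OF G assms(3)]
  \<comment> \<open>Monotonicity of the square relies on \<open>lambda G2\<close> being
    nonnegative.\<close>
  also have "lambda G1 + lambda G2 + (lambda G2)\<^sup>2 \<le> l1 + l2 + l2\<^sup>2"
    by (intro add_mono power_mono le lambda_nonneg G)
  finally show ?thesis
    using assms regular_graph_zigzag[OF G assms(3)]
    by (simp add: spectral_graph_def zigzag_def card_cartesian_product power2_eq_square)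
qed

end
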